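(* Let $m\ge1$ and $A\in GL(m,\mathbb{R})$. Then exactly one of the following alternatives holds: 1. $A$ possesses the $K$-FS-property for every simplicial cone $K\subset\mathbb{R}^m$; this condition is equivalent to: $A$ possesses the $K$-Q-property for every simplicial cone $K$; and also equivalent to: $A$ possesses the $K$-P-property for every simplicial cone $K$. 2. There is no simplicial cone $K\subset\mathbb{R}^m$ for which $A$ possesses the $K$-FS-property. 3. There exists a simplicial cone $K\subset\mathbb{R}^m$ for which $A$ does not have the $K$-FS-property, and there exists a simplicial cone $L\subset\mathbb{R}^m$ for which $A$ possesses the $L$-Q-property.
   Context: $\mathbb{R}^m$ is the space of column vectors with the standard scalar product $\langle\cdot,\cdot\rangle$, and $x\perp y$ means $\langle x,y\rangle=0$. $GL(m,\mathbb{R})$ is the group of invertible real $m\times m$ matrices (linear maps and matrices are identified). A simplicial cone is a set $K=\{t_1x^1+\dots+t_mx^m: t_i\ge 0,\ i=1,\dots,m\}$ with $x^1,\dots,x^m$ linearly independent vectors in $\mathbb{R}^m$. The dual of $K$ is $K^*=\{y\in\mathbb{R}^m:\langle x,y\rangle\ge 0\ \forall x\in K\}$. For a cone $K$, $A\in\mathbb{R}^{m\times m}$, $q\in\mathbb{R}^m$, the problem $\mathrm{LCP}(K,A,q)$ is to find $x\in\mathbb{R}^m$ with $x\in K$, $Ax+q\in K^*$ and $x\perp Ax+q$. The matrix $A$ has the $K$-Q-property if $\mathrm{LCP}(K,A,q)$ has a solution for all $q\in\mathbb{R}^m$; the $K$-P-property if $\mathrm{LCP}(K,A,q)$ has a unique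 solution for all $q\in\mathbb{R}^m$; the $K$-FS-property if $(AK+q)\cap K^*\neq\varnothing$ for all $q\in\mathbb{R}^m$. *)

theory Defs
  imports "HOL-Analysis.Analysis"
begin

text \<open>The generators form a linearly independent family indexed by the coordinate type, so there
  are exactly \<open>CARD('m)\<close> of them; injectivity excludes repetitions in the family, which
  independence of its range would not detect.\<close>

definition simplicial_cone :: "(real ^ 'm) set \<Rightarrow> bool" where
  "simplicial_cone K \<longleftrightarrow>
     (\<exists>x :: 'm \<Rightarrow> real ^ 'm. inj x \<and> independent (range x) \<and>
        K = {\<Sum>i\<in>UNIV. t i *\<^sub>R x i | t. \<forall>i. 0 \<le> t i})"

definition dual_cone :: "(real ^ 'm) set \<Rightarrow> (real ^ 'm) set" where
  "dual_cone K = {y. \<forall>x\<in>K. 0 \<le> x \<bullet> y}"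

definition LCP_solution ::
    "(real ^ 'm) set \<Rightarrow> real ^ 'm ^ 'm \<Rightarrow> real ^ 'm \<Rightarrow> real ^ 'm \<Rightarrow> bool" where
  "LCP_solution K A q x \<longleftrightarrow>
     x \<in> K \<and> A *v x + q \<in> dual_cone K \<and> orthogonal x (A *v x + q)"

definition Q_property :: "(real ^ 'm) set \<Rightarrow> real ^ 'm ^ 'm \<Rightarrow> bool" where
  "Q_property K A \<longleftrightarrow> (\<forall>q. \<exists>x. LCP_solution K A q x)"

definition P_property :: "(real ^ 'm) set \<Rightarrow> real ^ 'm ^ 'm \<Rightarrow> bool" where
  "P_property K A \<longleftrightarrow> (\<forall>q. \<exists>!x. LCP_solution K A q x)"

definition FS_property :: "(real ^ 'm) set \<Rightarrow> real ^ 'm ^ 'm \<Rightarrow> bool" where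
  "FS_property K A \<longleftrightarrow> (\<forall>q. (\<lambda>x. A *v x + q) ` K \<inter> dual_cone K \<noteq> {})"

definition exactly_one_of_three :: "bool \<Rightarrow> bool \<Rightarrow> bool \<Rightarrow> bool" where
  "exactly_one_of_three a b c \<longleftrightarrow>
     (a \<or> b \<or> c) \<and> \<not> (a \<and> b) \<and> \<not> (a \<and> c) \<and> \<not> (b \<and> c)"

end

theory Submission
  imports Defs
begin

text \<open>Everything is decided by the quadratic form \<open>x \<bullet> A x\<close>. If it is positive away from the
  origin, every linear complementarity problem on a simplicial cone is uniquely solvable. If it is
  nonpositive at some \<open>x \<noteq> 0\<close>, there is a simplicial cone \<open>K\<close> with \<open>x \<in> K\<close> and
  \<open>- A\<^sup>T x \<in> K\<^sup>*\<close>; then \<open>x \<bullet> (A y + q) \<le> x \<bullet> q\<close> for all \<open>y \<in> K\<close>, so feasibility fails for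
  \<open>q = - x\<close>. Feasibility on a single simplicial cone forces the form to be positive somewhere, and
  around such a point there is a narrow simplicial cone on whose generators \<open>(u, v) \<mapsto> u \<bullet> A v\<close> is
  positive, so that \<open>A\<close> is strictly copositive on it.\<close>

section \<open>Simplicial cones: independence of generators and matrix form\<close>

text \<open>Injectivity lets a relation among the vectors of the range be reindexed as a relation on
  the family, the form in which column independence of a matrix is stated.\<close>

lemma inj_independent_range_iff:
  fixes x :: "'m::finite \<Rightarrow> 'a::real_vector"
  shows "inj x \<and> independent (range x) \<longleftrightarrow>
           (\<forall>c. (\<Sum>i\<in>UNIV. c i *\<^sub>R x i) = 0 \<longrightarrow> (\<forall>i. c i = 0))" (is "?L \<longleftrightarrow> ?R")
proof
  assume L: ?L
  show ?R
  proof (intro allI impI)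
    fix c i
    assume c: "(\<Sum>i\<in>UNIV. c i *\<^sub>R x i) = 0"
    have "(\<Sum>v\<in>range x. c (inv x v) *\<^sub>R v) = 0"
      using L c by (simp add: sum.reindex)
    then have "c (inv x (x i)) = 0"
      using L independentD[of "range x" "range x" "\<lambda>v. c (inv x v)" "x i"] by simp
    then show "c i = 0"
      using L by simp
  qed
next
  assume R: ?R
  have "inj x"
  proof (rule injI, rule ccontr)
    fix i j
    assume "x i = x j" "i \<noteq> j"
    define c where "c = (\<lambda>k. if k = i then 1 else if k = j then - 1 else (0::real))"
    have "(\<Sum>k\<in>UNIV. c k *\<^sub>R x k) = (\<Sum>k\<in>{i, j}. c k *\<^sub>R x k)"
      by (rule sum.mono_neutral_right) (auto simp: c_def)
    also have "\<dots> = 0"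
      using \<open>x i = x j\<close> \<open>i \<noteq> j\<close> by (simp add: c_def)
    finally have "c i = 0"
      using R by blast
    then show False
      by (simp add: c_def)
  qed
  moreover have "independent (range x)"
    using R[rule_format, of "\<lambda>i. u (x i)" for u] \<open>inj x\<close>
    by (auto simp: dependent_finite sum.reindex)
  ultimately show ?L ..
qed

lemma simplicial_coneI:
  fixes x :: "'m::finite \<Rightarrow> real ^ 'm"
  assumes "\<And>c i. (\<Sum>i\<in>UNIV. c i *\<^sub>R x i) = 0 \<Longrightarrow> c i = 0"
  shows "simplicial_cone {\<Sum>i\<in>UNIV. t i *\<^sub>R x i | t. \<forall>i. 0 \<le> t i}"
proof -
  have "inj x \<and> independent (range x)"
    using assms inj_independent_range_iff by blast
  then show ?thesis
    unfolding simplicial_cone_def by blast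
qed

text \<open>The matrix \<open>M\<close> has the generators as columns, so the cone is a linear image
  of the nonnegative orthant; closedness and convexity can then be transferred from the
  orthant.\<close>

lemma simplicial_coneE:
  fixes K :: "(real ^ 'm) set"
  assumes "simplicial_cone K"
  obtains M :: "real ^ 'm ^ 'm"
    where "invertible M" "K = (\<lambda>t. M *v t) ` {t. \<forall>i. 0 \<le> t $ i}"
proof -
  obtain x :: "'m \<Rightarrow> real ^ 'm" where x: "inj x \<and> independent (range x)"
    and K: "K = {\<Sum>i\<in>UNIV. t i *\<^sub>R x i | t. \<forall>i. 0 \<le> t i}"
    using assms unfolding simplicial_cone_def by auto
  define M :: "real ^ 'm ^ 'm" where "M = (\<chi> a b. x b $ a)"
  have col: "column i M = x i" for i
    by (simp add: M_def column_def vec_eq_iff)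
  have "\<exists>B. B ** M = mat 1"
    using x unfolding matrix_left_invertible_independent_columns inj_independent_range_iff
    by (simp add: col scalar_mult_eq_scaleR)
  then have "invertible M"
    by (simp add: invertible_left_inverse)
  have Mv: "M *v t = (\<Sum>i\<in>UNIV. t $ i *\<^sub>R x i)" for t
    by (simp add: matrix_mult_sum col scalar_mult_eq_scaleR)
  have "y \<in> (\<lambda>t. M *v t) ` {t. \<forall>i. 0 \<le> t $ i}" if "y \<in> K" for y
  proof -
    from that obtain t where "y = (\<Sum>i\<in>UNIV. t i *\<^sub>R x i)" "\<forall>i. 0 \<le> t i"
      unfolding K by blast
    then show ?thesis
      by (intro image_eqI[where x = "\<chi> i. t i"]) (auto simp: Mv)
  qed
  moreover have "M *v t \<in> K" if "\<forall>i. 0 \<le> t $ i" for t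
    unfolding K Mv using that by (intro CollectI exI[where x = "\<lambda>i. t $ i"]) auto
  ultimately have "K = (\<lambda>t. M *v t) ` {t. \<forall>i. 0 \<le> t $ i}"
    by blast
  with \<open>invertible M\<close> show ?thesis
    by (rule that)
qed

lemma
  fixes K :: "(real ^ 'm) set"
  assumes "simplicial_cone K"
  shows simplicial_cone_closed: "closed K"
    and simplicial_cone_convex_cone: "convex_cone K"
proof -
  obtain M :: "real ^ 'm ^ 'm"
    where M: "invertible M" and K: "K = (\<lambda>t. M *v t) ` {t. \<forall>i. 0 \<le> t $ i}"
    using assms by (rule simplicial_coneE)
  have "closed {t :: real ^ 'm. \<forall>i. 0 \<le> t $ i}"
    by (intro closed_Collect_all closed_Collect_le continuous_intros)
  then show "closed K"
    unfolding K using M by (intro closed_injective_linear_image) (auto simp: inj_matrix_vector_mult)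
  have "convex_cone {t :: real ^ 'm. \<forall>i. 0 \<le> t $ i}"
    by (auto simp: convex_cone_iff)
  then show "convex_cone K"
    unfolding K by (intro convex_cone_linear_image conjI) auto
qed

section \<open>Solvability and uniqueness from positivity of the quadratic form\<close>

text \<open>By coercivity, a solution of the variational inequality on a large truncation of the cone
  does not touch the truncating ball and therefore solves the complementarity problem.\<close>

lemma strictly_copositive_imp_Q_property:
  fixes A :: "real ^ 'm ^ 'm"
  assumes "closed K" "convex_cone K"
    and pos: "\<And>x. x \<in> K \<Longrightarrow> x \<noteq> 0 \<Longrightarrow> 0 < x \<bullet> (A *v x)"
  shows "Q_property K A"
  unfolding Q_property_def
proof
  fix q
  \<comment> \<open>By homogeneity, \<open>c\<close> can be the minimum of the form over the unit
    vectors of \<open>K\<close>. If there are none, then \<open>K\<close> is trivial and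
    \<open>c = 1\<close> serves.\<close>
  obtain c where "c > 0" and c: "\<And>x. x \<in> K \<Longrightarrow> c * (norm x)\<^sup>2 \<le> x \<bullet> (A *v x)"
  proof (cases "K \<inter> sphere 0 1 = {}")
    case True
    have "x = 0" if "x \<in> K" for x
    proof (rule ccontr)
      assume "x \<noteq> 0"
      then have "(1 / norm x) *\<^sub>R x \<in> K \<inter> sphere 0 1"
        using assms(2) that by (auto intro: convex_cone_scaleR)
      with True show False by blast
    qed
    then show ?thesis
      using that[of 1] by force
  next
    case False
    have "compact (K \<inter> sphere 0 1)"
      using assms(1) by (simp add: closed_Int_compact)
    moreover have "continuous_on (K \<inter> sphere 0 1) (\<lambda>x. x \<bullet> (A *v x))"
      by (intro continuous_intros)
    ultimately obtain z where z: "z \<in> K \<inter> sphere 0 1"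
      and min: "\<And>y. y \<in> K \<inter> sphere 0 1 \<Longrightarrow> z \<bullet> (A *v z) \<le> y \<bullet> (A *v y)"
      using continuous_attains_inf[OF _ False] by blast
    have "(z \<bullet> (A *v z)) * (norm x)\<^sup>2 \<le> x \<bullet> (A *v x)" if "x \<in> K" for x
    proof (cases "x = 0")
      case nz: False
      define y where "y = (1 / norm x) *\<^sub>R x"
      have "y \<in> K \<inter> sphere 0 1"
        using nz assms(2) that by (auto simp: y_def intro: convex_cone_scaleR)
      then have "(z \<bullet> (A *v z)) * (norm x)\<^sup>2 \<le> (y \<bullet> (A *v y)) * (norm x)\<^sup>2"
        by (intro mult_right_mono min) auto
      also have "\<dots> = x \<bullet> (A *v x)"
        using nz by (simp add: y_def matrix_vector_mult_scaleR power2_eq_square)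
      finally show ?thesis .
    qed simp
    moreover have "z \<bullet> (A *v z) > 0"
      using z by (intro pos) auto
    ultimately show ?thesis
      using that by blast
  qed
  define F where "F = (\<lambda>x. A *v x + q)"
  \<comment> \<open>The bound \<open>c * norm x \<le> norm q\<close> derived below must force
    \<open>norm x < R\<close>; the summand 1 makes this strict and keeps \<open>R\<close> positive
    when \<open>q = 0\<close>.\<close>
  define R where "R = norm q / c + 1"
  have "R > 0"
    using \<open>c > 0\<close> by (simp add: R_def add_nonneg_pos)
  define S where "S = K \<inter> cball 0 R"
  have "0 \<in> K"
    using assms(2) by (rule convex_cone_contains_0)
  have S: "compact S" "closed S" "convex S" "0 \<in> S"
    using assms(1,2) \<open>0 \<in> K\<close> \<open>R > 0\<close>
    by (auto simp: S_def closed_Int_compact convex_Int convex_cone_def)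
  \<comment> \<open>Fixed points of this projected map, supplied by Brouwer, are exactly what the
    variational inequality on \<open>S\<close> needs.\<close>
  have "continuous_on S (\<lambda>x. closest_point S (x - F x))"
    unfolding F_def using S
    by (intro continuous_on_compose2[OF continuous_on_closest_point[of S UNIV]] continuous_intros)
       auto
  moreover have "(\<lambda>x. closest_point S (x - F x)) \<in> S \<rightarrow> S"
    using S closest_point_in_set by blast
  ultimately obtain x where "x \<in> S" and fixpoint: "closest_point S (x - F x) = x"
    using brouwer[of S] S by blast
  have VI: "0 \<le> F x \<bullet> (y - x)" if "y \<in> S" for y
    using closest_point_dot[OF S(3,2) that, of "x - F x"] by (simp add: fixpoint)
  have "x \<in> K"
    using \<open>x \<in> S\<close> by (simp add: S_def)
  have "norm x < R"
  proof (cases "x = 0")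
    case False
    have "c * (norm x)\<^sup>2 \<le> x \<bullet> (A *v x)"
      using \<open>x \<in> K\<close> by (rule c)
    also have "\<dots> \<le> - (q \<bullet> x)"
      using VI[OF \<open>0 \<in> S\<close>] by (simp add: F_def inner_add_left inner_commute[of x])
    also have "\<dots> \<le> norm q * norm x"
      using Cauchy_Schwarz_ineq2[of q x] by linarith
    finally have "c * norm x \<le> norm q"
      using False by (simp add: power2_eq_square)
    then show ?thesis
      using \<open>c > 0\<close> by (simp add: R_def field_simps)
  qed (use \<open>R > 0\<close> in simp)
  have VIK: "0 \<le> F x \<bullet> (y - x)" if "y \<in> K" for y
  proof -
    \<comment> \<open>Since \<open>x\<close> is interior to the ball, a short enough step towards
      \<open>y\<close> stays in \<open>S\<close>; the 1 in the denominator covers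
      \<open>y = x\<close>.\<close>
    define s where "s = min 1 ((R - norm x) / (norm (y - x) + 1))"
    have "0 < norm (y - x) + 1"
      by (simp add: add_nonneg_pos)
    then have s: "0 < s" "s \<le> 1"
      using \<open>norm x < R\<close> by (auto simp: s_def)
    have "s * norm (y - x) \<le> s * (norm (y - x) + 1)"
      using s by simp
    also have "\<dots> \<le> (R - norm x) / (norm (y - x) + 1) * (norm (y - x) + 1)"
      using \<open>0 < norm (y - x) + 1\<close> by (intro mult_right_mono) (auto simp: s_def)
    also have "\<dots> = R - norm x"
      using \<open>0 < norm (y - x) + 1\<close> by simp
    finally have "norm (x + s *\<^sub>R (y - x)) \<le> R"
      using norm_triangle_ineq[of x "s *\<^sub>R (y - x)"] s by simp
    moreover have "x + s *\<^sub>R (y - x) = (1 - s) *\<^sub>R x + s *\<^sub>R y"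
      by (simp add: algebra_simps)
    then have "x + s *\<^sub>R (y - x) \<in> K"
      using s that \<open>x \<in> K\<close> assms(2) by (auto intro!: convex_cone_add convex_cone_scaleR)
    ultimately have "x + s *\<^sub>R (y - x) \<in> S"
      by (simp add: S_def)
    from VI[OF this] show ?thesis
      using s by (simp add: zero_le_mult_iff)
  qed
  \<comment> \<open>Testing with \<open>2 *\<^sub>R x\<close> and with 0 bounds
    \<open>F x \<bullet> x\<close> from both sides by 0.\<close>
  have "2 *\<^sub>R x \<in> K"
    using \<open>x \<in> K\<close> assms(2) by (simp add: convex_cone_scaleR)
  from VIK[OF this] VIK[OF \<open>0 \<in> K\<close>] have "F x \<bullet> x = 0"
    by (simp add: scaleR_2)
  then have "0 \<le> y \<bullet> F x" if "y \<in> K" for y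
    using VIK[OF that] by (simp add: inner_diff_right inner_commute)
  with \<open>x \<in> K\<close> \<open>F x \<bullet> x = 0\<close> show "\<exists>x. LCP_solution K A q x"
    unfolding LCP_solution_def dual_cone_def orthogonal_def F_def
    by (intro exI[of _ x]) (auto simp: inner_commute)
qed

text \<open>In the form evaluated at \<open>x - y\<close>, complementarity removes the diagonal
  terms, and the two remaining cross terms are nonpositive by duality.\<close>

lemma LCP_solution_unique:
  fixes A :: "real ^ 'm ^ 'm"
  assumes pos: "\<And>x. x \<noteq> 0 \<Longrightarrow> 0 < x \<bullet> (A *v x)"
    and x: "LCP_solution K A q x" and y: "LCP_solution K A q y"
  shows "x = y"
proof (rule ccontr)
  assume "x \<noteq> y"
  then have "0 < (x - y) \<bullet> (A *v (x - y))"
    by (intro pos) simp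
  also have "A *v (x - y) = (A *v x + q) - (A *v y + q)"
    by (simp add: matrix_vector_mult_diff_distrib)
  also have "(x - y) \<bullet> \<dots> = - (x \<bullet> (A *v y + q)) - y \<bullet> (A *v x + q)"
    using x y unfolding LCP_solution_def orthogonal_def
    by (simp add: inner_diff_left inner_diff_right inner_add_right)
  also have "\<dots> \<le> 0"
    using x y unfolding LCP_solution_def dual_cone_def by (smt (verit) mem_Collect_eq)
  finally show False
    by simp
qed

section \<open>Relations among the three properties\<close>

lemma Q_property_imp_FS_property: "Q_property K A \<Longrightarrow> FS_property K A"
  unfolding Q_property_def FS_property_def LCP_solution_def by blast

lemma P_property_imp_Q_property: "P_property K A \<Longrightarrow> Q_property K A"
  unfolding P_property_def Q_property_def by blast

lemma positive_definite_imp_P_property: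
  fixes A :: "real ^ 'm ^ 'm"
  assumes "\<And>x. x \<noteq> 0 \<Longrightarrow> 0 < x \<bullet> (A *v x)" "simplicial_cone K"
  shows "P_property K A"
proof -
  have "Q_property K A"
    using assms
    by (intro strictly_copositive_imp_Q_property simplicial_cone_closed simplicial_cone_convex_cone)
  then show ?thesis
    unfolding P_property_def Q_property_def using LCP_solution_unique[OF assms(1)] by blast
qed

section \<open>Signs of the quadratic form and the existence of suitable cones\<close>

text \<open>Choose \<open>q\<close> negative on all nonzero vectors of \<open>K\<close>. A feasible
  \<open>y\<close> is then nonzero, and \<open>0 \<le> y \<bullet> (A *v y + q)\<close> makes the
  form at \<open>y\<close> at least \<open>- (y \<bullet> q) > 0\<close>.\<close>

lemma FS_property_imp_positive_vector:
  fixes A :: "real ^ 'm ^ 'm"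
  assumes "simplicial_cone K" "FS_property K A"
  shows "\<exists>x. 0 < x \<bullet> (A *v x)"
proof -
  obtain M :: "real ^ 'm ^ 'm"
    where M: "invertible M" and K: "K = (\<lambda>t. M *v t) ` {t. \<forall>i. 0 \<le> t $ i}"
    using assms(1) by (rule simplicial_coneE)
  \<comment> \<open>This \<open>q\<close> has inner product -1 with every column of
    \<open>M\<close>, that is, with every generator.\<close>
  obtain q where q: "transpose M *v q = (\<chi> i. - 1)"
    using M transpose_invertible[of M] by (metis invertible_eq_bij bij_pointE)
  have qt: "(M *v t) \<bullet> q = - (\<Sum>i\<in>UNIV. t $ i)" for t
  proof -
    have "(M *v t) \<bullet> q = t \<bullet> (transpose M *v q)"
      by (metis dot_lmul_matrix inner_commute transpose_matrix_vector)
    also have "\<dots> = - (\<Sum>i\<in>UNIV. t $ i)"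
      unfolding q by (simp add: inner_vec_def sum_negf)
    finally show ?thesis .
  qed
  obtain t where t: "\<forall>i. 0 \<le> t $ i" and dual: "A *v (M *v t) + q \<in> dual_cone K"
    using assms(2) unfolding FS_property_def K by blast
  \<comment> \<open>At \<open>t = 0\<close>, feasibility would put \<open>q\<close> itself into the
    dual cone.\<close>
  have "t \<noteq> 0"
  proof
    assume "t = 0"
    fix k :: 'm
    have "M *v axis k 1 \<in> K"
      unfolding K by (auto simp: axis_def)
    then have "0 \<le> (M *v axis k 1) \<bullet> q"
      using dual \<open>t = 0\<close> unfolding dual_cone_def by simp
    also have "\<dots> = - 1"
      unfolding qt by (simp add: axis_def)
    finally show False
      by simp
  qed
  then obtain l where "t $ l \<noteq> 0"
    by (auto simp: vec_eq_iff)
  with t have "0 < t $ l"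
    by (simp add: order_less_le)
  then have "0 < (\<Sum>i\<in>UNIV. t $ i)"
    using t by (intro sum_pos2[of _ l]) auto
  moreover have "0 \<le> (M *v t) \<bullet> (A *v (M *v t) + q)"
    using dual t unfolding dual_cone_def K by blast
  ultimately have "0 < (M *v t) \<bullet> (A *v (M *v t))"
    by (simp add: inner_add_right qt)
  then show ?thesis ..
qed

lemma nonpositive_vector_imp_not_FS_property:
  fixes A :: "real ^ 'm ^ 'm"
  assumes "x \<noteq> 0" "x \<bullet> (A *v x) \<le> 0"
  shows "\<exists>K. simplicial_cone K \<and> \<not> FS_property K A"
proof -
  define v where "v = - (x v* A)"
  have vdot: "y \<bullet> v = - (x \<bullet> (A *v y))" for y
    by (simp add: v_def dot_lmul_matrix inner_commute[of y])
  obtain k where k: "x $ k \<noteq> 0"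
    using assms(1) by (auto simp: vec_eq_iff)
  \<comment> \<open>The signs make every coordinate generator pair nonnegatively with
    \<open>v\<close>, which is \<open>- A\<^sup>T x\<close>; \<open>x\<close> does so by assumption.
    As \<open>x $ k \<noteq> 0\<close>, \<open>x\<close> may replace the \<open>k\<close>-th basis
    vector.\<close>
  define b :: "'m \<Rightarrow> real ^ 'm" where
    "b = (\<lambda>i. if i = k then x else axis i (if 0 \<le> v $ i then 1 else - 1))"
  define K where "K = {\<Sum>i\<in>UNIV. t i *\<^sub>R b i | t. \<forall>i. 0 \<le> t i}"
  have "simplicial_cone K"
    unfolding K_def
  proof (rule simplicial_coneI)
    fix c i
    assume c: "(\<Sum>i\<in>UNIV. c i *\<^sub>R b i) = 0"
    have comp: "(\<Sum>i\<in>UNIV. c i * b i $ j) = 0" for j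
      using arg_cong[OF c, of "\<lambda>w. w $ j"] by simp
    \<comment> \<open>Only \<open>b k = x\<close> has a nonzero \<open>k\<close>-th coordinate; once
      \<open>c k = 0\<close>, the remaining system is diagonal.\<close>
    have "(\<Sum>i\<in>UNIV. c i * b i $ k) = (\<Sum>i\<in>{k}. c i * b i $ k)"
      by (rule sum.mono_neutral_right) (auto simp: b_def axis_def)
    then have ck: "c k = 0"
      using comp[of k] k by (simp add: b_def)
    have "(\<Sum>j\<in>UNIV. c j * b j $ i) = (\<Sum>j\<in>{i}. c j * b j $ i)"
      by (rule sum.mono_neutral_right) (auto simp: b_def axis_def ck)
    then show "c i = 0"
      using comp[of i] ck by (cases "i = k") (auto simp: b_def axis_def split: if_splits)
  qed
  moreover have "\<not> FS_property K A"
  proof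
    assume "FS_property K A"
    then obtain y where y: "y \<in> K" "A *v y + (- x) \<in> dual_cone K"
      unfolding FS_property_def by blast
    have "(\<Sum>i\<in>UNIV. (if i = k then 1 else 0) *\<^sub>R b i) = x"
      by (simp add: if_distrib[of "\<lambda>r. r *\<^sub>R _"] b_def cong: if_cong)
    then have "x \<in> K"
      unfolding K_def by (intro CollectI exI[of _ "\<lambda>i. if i = k then 1 else 0"]) auto
    then have "0 \<le> x \<bullet> (A *v y + (- x))"
      using y(2) unfolding dual_cone_def by blast
    moreover have "0 \<le> b i \<bullet> v" for i
      using assms(2) vdot[of x] by (auto simp: b_def inner_axis')
    then have "0 \<le> y \<bullet> v"
      using y(1) unfolding K_def by (auto simp: inner_sum_left intro!: sum_nonneg)
    moreover have "0 < x \<bullet> x"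
      using assms(1) by simp
    ultimately show False
      by (simp add: inner_diff_right vdot)
  qed
  ultimately show ?thesis
    by blast
qed

lemma positive_vector_imp_Q_property:
  fixes A :: "real ^ 'm ^ 'm"
  assumes x: "0 < x \<bullet> (A *v x)"
  shows "\<exists>K. simplicial_cone K \<and> Q_property K A"
proof -
  have "x \<noteq> 0"
    using x by auto
  then obtain k where k: "x $ k \<noteq> 0"
    by (auto simp: vec_eq_iff)
  \<comment> \<open>At \<open>e = 0\<close> all generators collapse to \<open>x\<close> and all
    pairings equal \<open>x \<bullet> (A *v x) > 0\<close>, so they stay positive for small
    \<open>e\<close>. Leaving the \<open>k\<close>-th generator at \<open>x\<close> gives
    independence for \<open>e > 0\<close>, because \<open>x $ k \<noteq> 0\<close>.\<close>
  define b :: "real \<Rightarrow> 'm \<Rightarrow> real ^ 'm" where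
    "b = (\<lambda>e i. x + (if i = k then 0 else e) *\<^sub>R axis i 1)"
  have "((\<lambda>e. b e i \<bullet> (A *v b e j)) \<longlongrightarrow> b 0 i \<bullet> (A *v b 0 j)) (at_right 0)" for i j
  proof -
    have "continuous_on UNIV (\<lambda>e. b e i \<bullet> (A *v b e j))"
      unfolding b_def matrix_vector_right_distrib matrix_vector_mult_scaleR
      by (cases "i = k"; cases "j = k") (auto intro!: continuous_intros)
    then show ?thesis
      by (auto simp: continuous_on_def intro: tendsto_within_subset)
  qed
  then have "\<forall>\<^sub>F e in at_right 0. 0 < b e i \<bullet> (A *v b e j)" for i j
    using x by (intro order_tendstoD(1)) (auto simp: b_def)
  then have "\<forall>\<^sub>F e in at_right 0. \<forall>i j. 0 < b e i \<bullet> (A *v b e j)"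
    by (intro eventually_all_finite)
  then have "\<forall>\<^sub>F e in at_right 0. 0 < e \<and> (\<forall>i j. 0 < b e i \<bullet> (A *v b e j))"
    using eventually_at_right_less[of 0] by eventually_elim auto
  then obtain e where "0 < e" and pos: "\<And>i j. 0 < b e i \<bullet> (A *v b e j)"
    using eventually_happens' by (metis (no_types, lifting) trivial_limit_at_right_real)
  define K where "K = {\<Sum>i\<in>UNIV. t i *\<^sub>R b e i | t. \<forall>i. 0 \<le> t i}"
  have "simplicial_cone K"
    unfolding K_def
  proof (rule simplicial_coneI)
    fix c i
    assume c: "(\<Sum>i\<in>UNIV. c i *\<^sub>R b e i) = 0"
    \<comment> \<open>At \<open>j = k\<close> this equation shows that the coefficients sum to 0;
      the other coordinates then give \<open>c j * e = 0\<close>.\<close>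
    have comp: "(\<Sum>i\<in>UNIV. c i) * x $ j + (if j = k then 0 else c j * e) = 0" for j
    proof -
      have "(\<Sum>i\<in>UNIV. c i * b e i $ j)
          = (\<Sum>i\<in>UNIV. c i * x $ j + (if i = j then (if j = k then 0 else c j * e) else 0))"
        by (rule sum.cong) (auto simp: b_def axis_def algebra_simps)
      then show ?thesis
        using arg_cong[OF c, of "\<lambda>w. w $ j"] by (simp add: sum.distrib sum_distrib_right)
    qed
    have sum0: "(\<Sum>i\<in>UNIV. c i) = 0"
      using comp[of k] k by simp
    then have off: "c j = 0" if "j \<noteq> k" for j
      using comp[of j] that \<open>0 < e\<close> by simp
    have "(\<Sum>i\<in>UNIV. c i) = (\<Sum>i\<in>{k}. c i)"
      by (rule sum.mono_neutral_right) (auto simp: off)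
    then show "c i = 0"
      using sum0 off by (cases "i = k") auto
  qed
  moreover have "Q_property K A"
  proof (rule strictly_copositive_imp_Q_property)
    fix y
    assume "y \<in> K" "y \<noteq> 0"
    then obtain t where y: "y = (\<Sum>i\<in>UNIV. t i *\<^sub>R b e i)" and t: "\<And>i. 0 \<le> t i"
      unfolding K_def by blast
    obtain l where "t l \<noteq> 0"
      using \<open>y \<noteq> 0\<close> unfolding y by (metis (no_types, lifting) scale_zero_left sum.neutral)
    then have "0 < t l"
      using t[of l] by simp
    \<comment> \<open>All terms of the expansion are nonnegative, and the one with both indices
      \<open>l\<close> is positive.\<close>
    have "y \<bullet> (A *v y) = (\<Sum>i\<in>UNIV. \<Sum>j\<in>UNIV. t i * t j * (b e j \<bullet> (A *v b e i)))"
      unfolding y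
      by (simp add: linear_sum[OF matrix_vector_mul_linear] matrix_vector_mult_scaleR
          inner_sum_left inner_sum_right sum_distrib_left mult.assoc mult.left_commute)
    also have "\<dots> > 0"
      using t pos \<open>0 < t l\<close>
      by (intro sum_pos2[of _ l] sum_nonneg mult_nonneg_nonneg mult_pos_pos)
         (auto intro: less_imp_le)
    finally show "0 < y \<bullet> (A *v y)" .
  qed (use \<open>simplicial_cone K\<close> in \<open>auto intro: simplicial_cone_closed simplicial_cone_convex_cone\<close>)
  ultimately show ?thesis
    by blast
qed

section \<open>The trichotomy and the equivalences\<close>

theorem corollary4:
  fixes A :: "real ^ 'm ^ 'm"
  assumes "invertible A"
  shows "exactly_one_of_three
           (\<forall>K. simplicial_cone K \<longrightarrow> FS_property K A)
           (\<not> (\<exists>K. simplicial_cone K \<and> FS_property K A))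
           ((\<exists>K. simplicial_cone K \<and> \<not> FS_property K A) \<and>
            (\<exists>L. simplicial_cone L \<and> Q_property L A))
       \<and> ((\<forall>K. simplicial_cone K \<longrightarrow> FS_property K A) \<longleftrightarrow>
          (\<forall>K. simplicial_cone K \<longrightarrow> Q_property K A))
       \<and> ((\<forall>K. simplicial_cone K \<longrightarrow> FS_property K A) \<longleftrightarrow>
          (\<forall>K. simplicial_cone K \<longrightarrow> P_property K A))"
proof -
  \<comment> \<open>Alternatives 1 and 2 exclude each other only because a simplicial cone exists;
    the identity matrix and any coordinate vector provide one.\<close>
  have "\<exists>K :: (real ^ 'm) set. simplicial_cone K"
    using positive_vector_imp_Q_property[of "axis undefined 1" "mat 1 :: real ^ 'm ^ 'm"] by auto
  \<comment> \<open>Feasibility on all cones rules out nonzero vectors with nonpositive form, hence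
    yields unique solvability and closes the cycle of implications.\<close>
  moreover have "P_property K A"
    if "\<forall>K. simplicial_cone K \<longrightarrow> FS_property K A" "simplicial_cone K" for K
    using that nonpositive_vector_imp_not_FS_property[of _ A]
    by (intro positive_definite_imp_P_property) (meson not_le)
  moreover have "\<exists>L. simplicial_cone L \<and> Q_property L A"
    if "simplicial_cone K" "FS_property K A" for K
    using FS_property_imp_positive_vector[OF that] positive_vector_imp_Q_property by blast
  ultimately show ?thesis
    unfolding exactly_one_of_three_def
    by (meson P_property_imp_Q_property Q_property_imp_FS_property)
qed

end
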